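(* Let $\mathfrak q$ be a finite-dimensional algebraic Lie algebra over $\Bbbk$, and let $\widehat D$ be a (locally finite-dimensional) near-derivation of $(\mathcal S(\mathfrak q),\{\ ,\,\})$ such that $\{\ ,\,\}$ and $\{\ ,\,\}'_{\widehat D}$ are linearly independent. Let $\mathcal Z_{\widehat D}$ be the subalgebra of $(\mathcal S(\mathfrak q),\cdot)$ generated by all elements $\widehat D^{\,n}(z)$ with $z\in\mathcal Z\mathcal S(\mathfrak q)$ and $n=0,1,2,\dots$. For $s\in\Bbbk$, let $$\{F,H\}_{(s)}=e^{s\widehat D}\bigl\{e^{-s\widehat D}(F),e^{-s\widehat D}(H)\bigr\},\qquad F,H\in\mathcal S(\mathfrak q),$$ let $\mathcal Z\mathcal S(\mathfrak q)_{(s)}=\{F\in\mathcal S(\mathfrak q)\mid \{F,H\}_{(s)}=0\ \forall H\in\mathcal S(\mathfrak q)\}$ be the corresponding centre, and let $\mathcal Z_\times$ be the subalgebra of $(\mathcal S(\mathfrak q),\cdot)$ generated by all $\mathcal Z\mathcal S(\mathfrak q)_{(s)}$, $s\in\Bbbk$. Then $\mathcal Z_{\widehat D}=\mathcal Z_\times$.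
   Context: $\Bbbk$ is the ground field; a Lie algebra is algebraic if it is the Lie algebra of an algebraic group. $\mathcal S(\mathfrak q)$ is the symmetric algebra of $\mathfrak q$ with its usual commutative multiplication $\cdot$ and its Poisson bracket $\{\ ,\,\}$, the unique bracket extending the Lie bracket of $\mathfrak q$ and satisfying the Leibniz rule. $\mathcal Z\mathcal S(\mathfrak q)=\{f\in\mathcal S(\mathfrak q)\mid\{f,h\}=0\ \forall h\in\mathcal S(\mathfrak q)\}$ is the Poisson centre. For a vector space $\mathcal A$ with bilinear operation $\psi$ and a linear map $D:\mathcal A\to\mathcal A$, the derived operation is $\psi'_D(x,y)=D(\psi(x,y))-\psi(Dx,y)-\psi(x,Dy)$, and $\psi''_D=(\psi'_D)'_D$. A near-derivation of $(\mathcal A,\psi)$ is a linear map $D$ with $\psi''_D\in\langle\psi,\psi'_D\rangle$ (linear span). $D$ is locally finite-dimensional if $\{D^nf\mid n\ge0\}$ spans a finite-dimensional space for every $f\in\mathcal A$; $e^{sD}=\sum_{n\ge0}\frac{s^n}{n!}D^n$ denotes the exponential of $sD$, an invertible linear map of $\mathcal A$. *)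

theory Defs
  imports Complex_Main "HOL-Library.Poly_Mapping" "Jordan_Normal_Form.Matrix"
begin

section \<open>Polynomial rings\<close>

text \<open>\<open>('x, 'k) mpoly\<close> is the ring of polynomials over \<open>'k\<close> in commuting variables indexed by
  \<open>'x\<close>: finitely supported maps from exponent vectors to coefficients.\<close>

type_synonym ('x, 'k) mpoly = "('x \<Rightarrow>\<^sub>0 nat) \<Rightarrow>\<^sub>0 'k"

definition smul :: "'k::comm_ring_1 \<Rightarrow> ('x, 'k) mpoly \<Rightarrow> ('x, 'k) mpoly" where
  "smul c F = Poly_Mapping.single 0 c * F"

definition var :: "'x \<Rightarrow> ('x, 'k::comm_ring_1) mpoly" where
  "var x = Poly_Mapping.single (Poly_Mapping.single x 1) 1"

definition eval_mpoly :: "('x \<Rightarrow> 'k::comm_ring_1) \<Rightarrow> ('x, 'k) mpoly \<Rightarrow> 'k" where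
  "eval_mpoly v f = (\<Sum>m\<in>Poly_Mapping.keys f.
     Poly_Mapping.lookup f m * (\<Prod>x\<in>Poly_Mapping.keys m. v x ^ Poly_Mapping.lookup m x))"

definition pd :: "'x \<Rightarrow> ('x, 'k::comm_ring_1) mpoly \<Rightarrow> ('x, 'k) mpoly" where
  "pd x f = (\<Sum>m\<in>Poly_Mapping.keys f. Poly_Mapping.single (m - Poly_Mapping.single x 1)
     (of_nat (Poly_Mapping.lookup m x) * Poly_Mapping.lookup f m))"

definition is_subalgebra :: "('x, 'k::field) mpoly set \<Rightarrow> bool" where
  "is_subalgebra A \<longleftrightarrow> module.subspace smul A \<and> 1 \<in> A \<and> (\<forall>F\<in>A. \<forall>G\<in>A. F * G \<in> A)"

definition generated_subalgebra :: "('x, 'k::field) mpoly set \<Rightarrow> ('x, 'k) mpoly set" where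
  "generated_subalgebra X = is_subalgebra hull X"


section \<open>Lie algebras and algebraic Lie algebras\<close>

locale lie_algebra = vector_space scl
  for scl :: "'k::field \<Rightarrow> 'q::ab_group_add \<Rightarrow> 'q" +
  fixes br :: "'q \<Rightarrow> 'q \<Rightarrow> 'q"
  assumes br_add_left: "br (x + y) z = br x z + br y z"
    and br_add_right: "br x (y + z) = br x y + br x z"
    and br_scl_left: "br (scl c x) y = scl c (br x y)"
    and br_scl_right: "br x (scl c y) = scl c (br x y)"
    and br_self: "br x x = 0"
    and br_jacobi: "br x (br y z) + br y (br z x) + br z (br x y) = 0"

text \<open>An algebraic group is taken to be linear, i.e. a Zariski-closed subgroup of some \<open>GL\<^sub>n\<close>, given
  by its rational points. In characteristic 0 the rational points of a connected linear group are
  dense, so they determine its Lie algebra.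
  Polynomial functions on \<open>n \<times> n\<close> matrices are polynomials in the variables \<open>(i, j)\<close>,
  \<open>i, j < n\<close>.\<close>

definition matrix_polys :: "nat \<Rightarrow> (nat \<times> nat, 'k::field) mpoly set" where
  "matrix_polys n =
     {f. \<forall>m\<in>Poly_Mapping.keys f. Poly_Mapping.keys m \<subseteq> {..<n} \<times> {..<n}}"

definition algebraic_matrix_group :: "nat \<Rightarrow> 'k::field mat set \<Rightarrow> bool" where
  "algebraic_matrix_group n G \<longleftrightarrow>
     1\<^sub>m n \<in> G \<and> (\<forall>A\<in>G. \<forall>B\<in>G. A * B \<in> G) \<and>
     (\<forall>A\<in>G. \<exists>B\<in>G. A * B = 1\<^sub>m n \<and> B * A = 1\<^sub>m n) \<and>
     (\<exists>E \<subseteq> matrix_polys n. G = {A \<in> carrier_mat n n. invertible_mat A \<and>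
        (\<forall>f\<in>E. eval_mpoly (($$) A) f = 0)})"

text \<open>The Lie algebra of \<open>G\<close> is the tangent space of \<open>G\<close> at the identity: the matrices
  annihilated by the differential at \<open>1\<close> of every polynomial vanishing on \<open>G\<close>. Its bracket is the
  commutator of matrices.\<close>

definition lie_of_matrix_group :: "nat \<Rightarrow> 'k::field mat set \<Rightarrow> 'k mat set" where
  "lie_of_matrix_group n G = {X \<in> carrier_mat n n.
     \<forall>f\<in>matrix_polys n. (\<forall>A\<in>G. eval_mpoly (($$) A) f = 0) \<longrightarrow>
       (\<Sum>i<n. \<Sum>j<n. eval_mpoly (($$) (1\<^sub>m n)) (pd (i, j) f) * X $$ (i, j)) = 0}"

definition algebraic_lie_algebra ::
    "('k::field \<Rightarrow> 'q::ab_group_add \<Rightarrow> 'q) \<Rightarrow> ('q \<Rightarrow> 'q \<Rightarrow> 'q) \<Rightarrow> bool" where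
  "algebraic_lie_algebra scl br \<longleftrightarrow>
     (\<exists>n G \<phi>. algebraic_matrix_group n G \<and> bij_betw \<phi> UNIV (lie_of_matrix_group n G) \<and>
        (\<forall>x y. \<phi> (x + y) = \<phi> x + \<phi> y) \<and> (\<forall>c x. \<phi> (scl c x) = c \<cdot>\<^sub>m \<phi> x) \<and>
        (\<forall>x y. \<phi> (br x y) = \<phi> x * \<phi> y - \<phi> y * \<phi> x))"


section \<open>The symmetric algebra and its Poisson bracket\<close>

definition indexed_basis :: "('k::field \<Rightarrow> 'q::ab_group_add \<Rightarrow> 'q) \<Rightarrow> ('i \<Rightarrow> 'q) \<Rightarrow> bool" where
  "indexed_basis scl b \<longleftrightarrow> inj b \<and> \<not> module.dependent scl (range b) \<and>
     module.span scl (range b) = UNIV"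

text \<open>For a basis \<open>b\<close> of \<open>\<qq>\<close> indexed by the finite type \<open>'i\<close>, the symmetric algebra of \<open>\<qq>\<close> is
  the polynomial ring \<open>('i, 'k) mpoly\<close>, and \<open>sym_incl\<close> is the inclusion of \<open>\<qq>\<close> as the space of
  linear forms; it sends \<open>b i\<close> to the variable \<open>i\<close>.\<close>

definition sym_incl ::
    "('k::field \<Rightarrow> 'q::ab_group_add \<Rightarrow> 'q) \<Rightarrow> ('i::finite \<Rightarrow> 'q) \<Rightarrow> 'q \<Rightarrow> ('i, 'k) mpoly" where
  "sym_incl scl b v =
     (\<Sum>i\<in>UNIV. smul (module.representation scl (range b) v (b i)) (var i))"

text \<open>The Leibniz rule in the first argument follows by skew-symmetry; the Jacobi identity follows
  from that of the Lie bracket.\<close>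

definition poisson_extension ::
    "('k::field \<Rightarrow> 'q::ab_group_add \<Rightarrow> 'q) \<Rightarrow> ('q \<Rightarrow> 'q \<Rightarrow> 'q) \<Rightarrow> ('i::finite \<Rightarrow> 'q) \<Rightarrow>
     (('i, 'k) mpoly \<Rightarrow> ('i, 'k) mpoly \<Rightarrow> ('i, 'k) mpoly) \<Rightarrow> bool" where
  "poisson_extension scl br b P \<longleftrightarrow>
     (\<forall>F G H. P F (G + H) = P F G + P F H) \<and> (\<forall>F G H. P (F + G) H = P F H + P G H) \<and>
     (\<forall>c F G. P F (smul c G) = smul c (P F G)) \<and> (\<forall>c F G. P (smul c F) G = smul c (P F G)) \<and>
     (\<forall>F. P F F = 0) \<and>
     (\<forall>F G H. P F (G * H) = P F G * H + G * P F H) \<and>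
     (\<forall>x y. P (sym_incl scl b x) (sym_incl scl b y) = sym_incl scl b (br x y))"

text \<open>Well-definedness is the lemma \<open>poisson_extension_ex1\<close> below.\<close>

definition poisson ::
    "('k::field \<Rightarrow> 'q::ab_group_add \<Rightarrow> 'q) \<Rightarrow> ('q \<Rightarrow> 'q \<Rightarrow> 'q) \<Rightarrow> ('i::finite \<Rightarrow> 'q) \<Rightarrow>
     ('i, 'k) mpoly \<Rightarrow> ('i, 'k) mpoly \<Rightarrow> ('i, 'k) mpoly" where
  "poisson scl br b = (THE P. poisson_extension scl br b P)"

definition centre :: "('a \<Rightarrow> 'a \<Rightarrow> 'a::zero) \<Rightarrow> 'a set" where
  "centre \<psi> = {F. \<forall>H. \<psi> F H = 0}"


section \<open>Near-derivations\<close>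

definition derived_op ::
    "('a::ab_group_add \<Rightarrow> 'a) \<Rightarrow> ('a \<Rightarrow> 'a \<Rightarrow> 'a) \<Rightarrow> 'a \<Rightarrow> 'a \<Rightarrow> 'a" where
  "derived_op D \<psi> x y = D (\<psi> x y) - \<psi> (D x) y - \<psi> x (D y)"

definition near_derivation ::
    "('k::field \<Rightarrow> 'a::ab_group_add \<Rightarrow> 'a) \<Rightarrow> ('a \<Rightarrow> 'a \<Rightarrow> 'a) \<Rightarrow> ('a \<Rightarrow> 'a) \<Rightarrow> bool" where
  "near_derivation scl \<psi> D \<longleftrightarrow> Vector_Spaces.linear scl scl D \<and>
     (\<exists>\<alpha> \<beta>. \<forall>x y. derived_op D (derived_op D \<psi>) x y =
        scl \<alpha> (\<psi> x y) + scl \<beta> (derived_op D \<psi> x y))"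

definition independent_ops ::
    "('k::field \<Rightarrow> 'a::ab_group_add \<Rightarrow> 'a) \<Rightarrow> ('a \<Rightarrow> 'a \<Rightarrow> 'a) \<Rightarrow> ('a \<Rightarrow> 'a \<Rightarrow> 'a) \<Rightarrow> bool" where
  "independent_ops scl \<psi> \<chi> \<longleftrightarrow>
     (\<forall>\<alpha> \<beta>. (\<forall>x y. scl \<alpha> (\<psi> x y) + scl \<beta> (\<chi> x y) = 0) \<longrightarrow> \<alpha> = 0 \<and> \<beta> = 0)"

definition locally_finite_dim ::
    "('k::field \<Rightarrow> 'a::ab_group_add \<Rightarrow> 'a) \<Rightarrow> ('a \<Rightarrow> 'a) \<Rightarrow> bool" where
  "locally_finite_dim scl D \<longleftrightarrow>
     (\<forall>f. \<exists>B. finite B \<and> module.span scl {(D ^^ n) f |n. True} \<subseteq> module.span scl B)"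


section \<open>Exponentials\<close>

text \<open>The series \<open>e\<^bsup>sD\<^esup>F = \<Sum>\<^sub>n s\<^sup>n/n! D\<^sup>n F\<close> needs a notion of convergence in the ground field, given
  here by an arbitrary absolute value. For the real and complex numbers with the usual absolute
  value, the series converges for every locally finite-dimensional \<open>D\<close>
  (\<open>exp_converges_norm\<close>); for any field with the trivial absolute value
  (\<open>av x = 1\<close> for \<open>x \<noteq> 0\<close>), convergence means that the sum is finite, as for locally
  nilpotent \<open>D\<close> (\<open>exp_converges_nilpotent\<close>).\<close>

definition absolute_value :: "('k::field \<Rightarrow> real) \<Rightarrow> bool" where
  "absolute_value av \<longleftrightarrow> (\<forall>x. av x \<ge> 0) \<and> (\<forall>x. av x = 0 \<longleftrightarrow> x = 0) \<and>
     (\<forall>x y. av (x * y) = av x * av y) \<and> (\<forall>x y. av (x + y) \<le> av x + av y)"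

text \<open>Convergence is coefficientwise. For locally finite-dimensional \<open>D\<close> all partial sums lie in one
  finite-dimensional space, hence involve only finitely many monomials, so this is the usual
  convergence there.\<close>

definition exp_sums ::
    "('k::field_char_0 \<Rightarrow> real) \<Rightarrow> 'k \<Rightarrow> (('x, 'k) mpoly \<Rightarrow> ('x, 'k) mpoly) \<Rightarrow>
     ('x, 'k) mpoly \<Rightarrow> ('x, 'k) mpoly \<Rightarrow> bool" where
  "exp_sums av s D F G \<longleftrightarrow> (\<forall>m.
     (\<lambda>N. av (Poly_Mapping.lookup ((\<Sum>n<N. smul (s ^ n / fact n) ((D ^^ n) F)) - G) m))
       \<longlonglongrightarrow> 0)"

definition exp_converges ::
    "('k::field_char_0 \<Rightarrow> real) \<Rightarrow> (('x, 'k) mpoly \<Rightarrow> ('x, 'k) mpoly) \<Rightarrow> bool" where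
  "exp_converges av D \<longleftrightarrow> (\<forall>s F. \<exists>G. exp_sums av s D F G)"

definition exp_map ::
    "('k::field_char_0 \<Rightarrow> real) \<Rightarrow> 'k \<Rightarrow> (('x, 'k) mpoly \<Rightarrow> ('x, 'k) mpoly) \<Rightarrow>
     ('x, 'k) mpoly \<Rightarrow> ('x, 'k) mpoly" where
  "exp_map av s D F = (THE G. exp_sums av s D F G)"

definition exp_transport ::
    "('k::field_char_0 \<Rightarrow> real) \<Rightarrow> 'k \<Rightarrow> (('x, 'k) mpoly \<Rightarrow> ('x, 'k) mpoly) \<Rightarrow>
     (('x, 'k) mpoly \<Rightarrow> ('x, 'k) mpoly \<Rightarrow> ('x, 'k) mpoly) \<Rightarrow>
     ('x, 'k) mpoly \<Rightarrow> ('x, 'k) mpoly \<Rightarrow> ('x, 'k) mpoly" where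
  "exp_transport av s D \<psi> F H =
     exp_map av s D (\<psi> (exp_map av (- s) D F) (exp_map av (- s) D H))"

section \<open>Well-definedness of the Poisson bracket\<close>

lemma smul_simps:
  fixes c d :: "'k::comm_ring_1" and F G :: "('x, 'k) mpoly"
  shows "smul c (F + G) = smul c F + smul c G" "smul (c + d) F = smul c F + smul d F"
    "smul c (smul d F) = smul (c * d) F" "smul 1 F = F" "smul 0 F = 0" "smul c 0 = 0"
    "smul c F * G = smul c (F * G)" "F * smul c G = smul c (F * G)"
    "smul c (Poly_Mapping.single m d) = Poly_Mapping.single m (c * d)"
  proof -
  have "Poly_Mapping.single (0 :: 'x \<Rightarrow>\<^sub>0 nat) c * Poly_Mapping.single 0 d = Poly_Mapping.single 0 (c * d)"
    by (simp add: mult_single)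
  then show "smul c (smul d F) = smul (c * d) F"
    by (metis smul_def mult.assoc)
qed (simp_all add: smul_def single_add algebra_simps mult_single)

lemma vector_space_smul: "vector_space (smul :: 'k::field \<Rightarrow> ('x, 'k) mpoly \<Rightarrow> _)"
proof
  fix c d :: 'k and F G :: "('x, 'k) mpoly"
  show "smul c (F + G) = smul c F + smul c G" by (simp add: smul_def algebra_simps)
  show "smul (c + d) F = smul c F + smul d F" by (simp add: smul_def single_add algebra_simps)
  show "smul c (smul d F) = smul (c * d) F" by (rule smul_simps)
  show "smul 1 F = F" by (simp add: smul_def)
qed

lemma smul_sum: "smul c (sum f A) = (\<Sum>a\<in>A. smul c (f a))"
  by (simp add: smul_def sum_distrib_left)

lemma lookup_smul: "Poly_Mapping.lookup (smul c F) m = c * Poly_Mapping.lookup F m"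
proof -
  have "smul c F = (\<Sum>k\<in>Poly_Mapping.keys F. Poly_Mapping.single k (c * Poly_Mapping.lookup F k))"
  proof -
    have "F = (\<Sum>k\<in>Poly_Mapping.keys F. Poly_Mapping.single k (Poly_Mapping.lookup F k))"
      by (rule poly_mapping_eqI)
        (auto simp: lookup_sum lookup_single when_def in_keys_iff sum.delta')
    then have "smul c F
        = Poly_Mapping.single 0 c * (\<Sum>k\<in>Poly_Mapping.keys F. Poly_Mapping.single k (Poly_Mapping.lookup F k))"
      by (simp add: smul_def)
    then show ?thesis by (simp add: sum_distrib_left mult_single)
  qed
  then show ?thesis
    by (auto simp: lookup_sum lookup_single when_def in_keys_iff)
qed

lemma poly_mapping_single_induct [case_names single add]:
  assumes "\<And>m c. Q (Poly_Mapping.single m c)" and "\<And>F G. Q F \<Longrightarrow> Q G \<Longrightarrow> Q (F + G)"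
  shows "Q (F :: 'a \<Rightarrow>\<^sub>0 'b::comm_monoid_add)"
proof -
  have "F = (\<Sum>k\<in>Poly_Mapping.keys F. Poly_Mapping.single k (Poly_Mapping.lookup F k))"
    by (rule poly_mapping_eqI)
      (auto simp: lookup_sum lookup_single when_def in_keys_iff sum.delta')
  moreover have "Q (\<Sum>k\<in>K. Poly_Mapping.single k (Poly_Mapping.lookup F k))" if "finite K" for K
    using that
  proof induction
    case empty
    then show ?case using assms(1)[of undefined 0] by simp
  next
    case (insert k K)
    then show ?case using assms by simp
  qed
  ultimately show ?thesis by (metis finite_keys)
qed

lemma sum_keys_superset:
  assumes "finite K" "Poly_Mapping.keys F \<subseteq> K" "\<And>m. g m 0 = 0"
  shows "(\<Sum>m\<in>Poly_Mapping.keys F. g m (Poly_Mapping.lookup F m)) =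
    (\<Sum>m\<in>K. g m (Poly_Mapping.lookup F m))"
  using assms by (intro sum.mono_neutral_left) (auto simp: in_keys_iff)

lemma pd_add: "pd x (F + G) = pd x F + pd x G"
proof -
  define K where "K = Poly_Mapping.keys F \<union> Poly_Mapping.keys G"
  have K: "finite K" "Poly_Mapping.keys F \<subseteq> K" "Poly_Mapping.keys G \<subseteq> K"
    "Poly_Mapping.keys (F + G) \<subseteq> K"
    using Poly_Mapping.keys_add[of F G] by (auto simp: K_def)
  have "pd x H = (\<Sum>m\<in>K. Poly_Mapping.single (m - Poly_Mapping.single x 1)
      (of_nat (Poly_Mapping.lookup m x) * Poly_Mapping.lookup H m))"
    if "Poly_Mapping.keys H \<subseteq> K" for H :: "('a, 'b) mpoly"
    unfolding pd_def
    by (rule sum_keys_superset[OF K(1) that,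
          where g = "\<lambda>m c. Poly_Mapping.single (m - Poly_Mapping.single x 1)
            (of_nat (Poly_Mapping.lookup m x) * c)"]) simp
  then show ?thesis using K
    by (simp add: lookup_add algebra_simps single_add sum.distrib)
qed

lemma pd_single: "pd x (Poly_Mapping.single m c) =
    Poly_Mapping.single (m - Poly_Mapping.single x 1) (of_nat (Poly_Mapping.lookup m x) * c)"
  by (cases "c = 0") (simp_all add: pd_def)

lemma pd_smul: "pd x (smul c F) = smul c (pd x F)"
  by (induction F rule: poly_mapping_single_induct) (simp_all add: smul_simps pd_single pd_add algebra_simps)

lemma pd_sum: "pd x (sum f A) = (\<Sum>a\<in>A. pd x (f a))"
  by (induction A rule: infinite_finite_induct) (simp_all add: pd_add pd_def[of _ 0])

lemma minus_single_add:
  "Poly_Mapping.lookup m x > 0 \<Longrightarrow>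
   m - Poly_Mapping.single x 1 + m' = m + m' - Poly_Mapping.single x (1::nat)"
  by (rule poly_mapping_eqI) (auto simp: lookup_add lookup_minus lookup_single when_def)

lemma pd_mult: "pd x (F * G) = pd x F * G + F * pd x G"
proof (induction F rule: poly_mapping_single_induct)
  case (single m c)
  show ?case
  proof (induction G rule: poly_mapping_single_induct)
    case (single m' c')
    have 1: "Poly_Mapping.single (m - Poly_Mapping.single x 1 + m') (of_nat (Poly_Mapping.lookup m x) * d)
        = Poly_Mapping.single (m + m' - Poly_Mapping.single x 1) (of_nat (Poly_Mapping.lookup m x) * d)"
      for d :: 'b
      by (cases "Poly_Mapping.lookup m x = 0") (simp_all add: minus_single_add del: One_nat_def)
    have 2: "Poly_Mapping.single (m + (m' - Poly_Mapping.single x 1)) (of_nat (Poly_Mapping.lookup m' x) * d)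
        = Poly_Mapping.single (m + m' - Poly_Mapping.single x 1) (of_nat (Poly_Mapping.lookup m' x) * d)"
      for d :: 'b
      using minus_single_add[of m' x m]
      by (cases "Poly_Mapping.lookup m' x = 0") (simp_all add: add.commute del: One_nat_def)
    have "pd x (Poly_Mapping.single m c) * Poly_Mapping.single m' c' =
        Poly_Mapping.single (m + m' - Poly_Mapping.single x 1) (of_nat (Poly_Mapping.lookup m x) * (c * c'))"
      using 1 by (simp add: pd_single mult_single mult.assoc)
    moreover have "Poly_Mapping.single m c * pd x (Poly_Mapping.single m' c') =
        Poly_Mapping.single (m + m' - Poly_Mapping.single x 1) (of_nat (Poly_Mapping.lookup m' x) * (c * c'))"
      using 2[of "c * c'"] by (simp add: pd_single mult_single mult.left_commute)
    ultimately show ?case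
      by (simp add: pd_single mult_single lookup_add distrib_right flip: single_add)
  next
    case (add F G)
    then show ?case by (simp add: pd_add algebra_simps)
  qed
next
  case (add F G)
  then show ?case by (simp add: pd_add algebra_simps)
qed

lemma pd_var: "pd x (var y) = (if x = y then 1 else 0)"
  by (simp add: var_def pd_single lookup_single when_def)

lemma subalgebra_vars:
  assumes "is_subalgebra A" "\<And>x. var x \<in> A"
  shows "F \<in> A"
proof -
  interpret vector_space smul by (rule vector_space_smul)
  have one: "1 \<in> A" and mult: "\<And>F G. F \<in> A \<Longrightarrow> G \<in> A \<Longrightarrow> F * G \<in> A" and sub: "subspace A"
    using assms(1) by (auto simp: is_subalgebra_def)
  have mon: "Poly_Mapping.single m 1 \<in> A" for m
  proof (induction m rule: poly_mapping_single_induct)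
    case (single k v)
    show ?case
    proof (induction v)
      case 0
      then show ?case using one by simp
    next
      case (Suc v)
      have "Poly_Mapping.single (Poly_Mapping.single k (Suc v)) 1
        = var k * Poly_Mapping.single (Poly_Mapping.single k v) (1::'b)"
        by (simp add: var_def mult_single flip: single_add)
      then show ?case using mult[OF assms(2) Suc] by simp
    qed
  next
    case (add f g)
    then show ?case using mult[of "Poly_Mapping.single f 1" "Poly_Mapping.single g 1"]
      by (simp add: mult_single)
  qed
  show ?thesis
  proof (induction F rule: poly_mapping_single_induct)
    case (single m c)
    have "Poly_Mapping.single m c = smul c (Poly_Mapping.single m 1)" by (simp add: smul_simps)
    then show ?case using subspace_scale[OF sub mon] by simp
  next
    case (add F G)
    then show ?case using subspace_add[OF sub] by blast
  qed
qed

lemma poisson_extension_ex1: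
  fixes scl :: "'k::field_char_0 \<Rightarrow> 'q::ab_group_add \<Rightarrow> 'q" and b :: "'i::finite \<Rightarrow> 'q"
  assumes lie: "lie_algebra scl br" and basis: "indexed_basis scl b"
  shows "\<exists>!P. poisson_extension scl br b P"
proof -
  interpret lie_algebra scl br by (rule lie)
  define \<iota> where "\<iota> = sym_incl scl b"
  define r where "r v i = representation (range b) v (b i)" for v i
  have ind: "independent (range b)" and sp: "span (range b) = UNIV" and inj: "inj b"
    using basis by (auto simp: indexed_basis_def)
  have r_add: "r (v + w) i = r v i + r w i" for v w i
    by (simp add: r_def representation_add[OF ind] sp)
  have r_scl: "r (scl c v) i = c * r v i" for c v i
    by (simp add: r_def representation_scale[OF ind] sp)
  have r_basis: "r (b j) i = (if i = j then 1 else 0)" for i j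
    using inj by (auto simp: r_def representation_basis[OF ind] inj_eq)
  have r_sum: "(\<Sum>i\<in>UNIV. scl (r v i) (b i)) = v" for v
  proof -
    have "(\<Sum>w\<in>range b. scl (representation (range b) v w) w) = v"
      by (rule sum_representation_eq[OF ind]) (auto simp: sp)
    then show ?thesis by (simp add: r_def sum.reindex[OF inj] o_def)
  qed
  have \<iota>_eq: "\<iota> v = (\<Sum>i\<in>UNIV. smul (r v i) (var i))" for v
    by (simp add: \<iota>_def r_def sym_incl_def)
  have \<iota>_add: "\<iota> (v + w) = \<iota> v + \<iota> w" for v w
    by (simp add: \<iota>_eq r_add smul_simps sum.distrib)
  have \<iota>_scl: "\<iota> (scl c v) = smul c (\<iota> v)" for c v
    by (simp add: \<iota>_eq r_scl smul_sum smul_simps)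
  have \<iota>_zero: "\<iota> 0 = 0" using \<iota>_scl[of 0 0] by (simp add: smul_simps)
  have \<iota>_sum: "\<iota> (sum f A) = (\<Sum>a\<in>A. \<iota> (f a))" for f and A :: "'i set"
    by (induction A rule: infinite_finite_induct) (simp_all add: \<iota>_add \<iota>_zero)
  have \<iota>_basis: "\<iota> (b j) = var j" for j
  proof -
    have "\<iota> (b j) = (\<Sum>i\<in>UNIV. if i = j then var i else 0)"
      unfolding \<iota>_eq by (rule sum.cong) (auto simp: r_basis smul_simps)
    then show ?thesis by simp
  qed
  have br_zero: "br 0 w = 0" "br w 0 = 0" for w
    using br_scl_left[of 0 0 w] br_scl_right[of w 0 0] by simp_all
  have br_sum_left: "br (sum f A) w = (\<Sum>a\<in>A. br (f a) w)" for f w and A :: "'i set"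
    by (induction A rule: infinite_finite_induct) (simp_all add: br_add_left br_zero)
  have br_sum_right: "br w (sum f A) = (\<Sum>a\<in>A. br w (f a))" for f w and A :: "'i set"
    by (induction A rule: infinite_finite_induct) (simp_all add: br_add_right br_zero)
  have br_skew: "br v w = - br w v" for v w
  proof -
    have "br (v + w) (v + w) = br v w + br w v"
      unfolding br_add_left br_add_right by (simp add: br_self)
    then show ?thesis unfolding br_self by (metis eq_neg_iff_add_eq_0)
  qed
  have \<iota>_minus: "\<iota> (- v) = - \<iota> v" for v
    using \<iota>_add[of v "- v"] by (simp add: \<iota>_zero add_eq_0_iff)
  define P where "P F G = (\<Sum>i\<in>UNIV. \<Sum>j\<in>UNIV. pd i F * pd j G * \<iota> (br (b i) (b j)))" for F G
  have "poisson_extension scl br b P"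
    unfolding poisson_extension_def
  proof (intro conjI allI)
    fix F G H :: "('i, 'k) mpoly" and c :: 'k and x y :: 'q
    show "P F (G + H) = P F G + P F H" "P (F + G) H = P F H + P G H"
      by (simp_all add: P_def pd_add algebra_simps sum.distrib)
    show "P F (smul c G) = smul c (P F G)" "P (smul c F) G = smul c (P F G)"
      by (simp_all add: P_def pd_smul smul_simps smul_sum)
    show "P F (G * H) = P F G * H + G * P F H"
      by (simp add: P_def pd_mult algebra_simps sum.distrib sum_distrib_left)
    show "P F F = 0"
    proof -
      have "P F F = (\<Sum>j\<in>UNIV. \<Sum>i\<in>UNIV. pd i F * pd j F * \<iota> (br (b i) (b j)))"
        unfolding P_def by (rule sum.swap)
      also have "\<dots> = (\<Sum>j\<in>UNIV. \<Sum>i\<in>UNIV. - (pd j F * pd i F * \<iota> (br (b j) (b i))))"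
        by (intro sum.cong refl) (subst br_skew, simp add: \<iota>_minus mult.commute)
      also have "\<dots> = - P F F" by (simp add: P_def sum_negf)
      finally have "P F F + P F F = 0" by simp
      then have "smul 2 (P F F) = 0"
        using smul_simps(2)[of 1 1 "P F F"] by (simp add: smul_simps(4))
      then have "smul (1 / 2) (smul 2 (P F F)) = 0" by (simp add: smul_simps(6))
      then show ?thesis unfolding smul_simps(3) by (simp add: smul_simps(4))
    qed
    have pd_\<iota>: "pd i (\<iota> v) = smul (r v i) 1" for i v
    proof -
      have "pd i (\<iota> v) = (\<Sum>j\<in>UNIV. if j = i then smul (r v i) 1 else 0)"
        unfolding \<iota>_eq pd_sum by (rule sum.cong) (auto simp: pd_smul pd_var smul_simps)
      then show ?thesis by simp
    qed
    have "\<iota> (br x y) = \<iota> (br (\<Sum>i\<in>UNIV. scl (r x i) (b i)) (\<Sum>j\<in>UNIV. scl (r y j) (b j)))"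
      by (simp add: r_sum)
    also have "\<dots> = P (\<iota> x) (\<iota> y)"
      by (subst br_sum_left) (simp add: br_sum_right br_scl_left br_scl_right \<iota>_sum \<iota>_scl P_def
          pd_\<iota> smul_simps smul_sum mult.commute)
    finally show "P (sym_incl scl b x) (sym_incl scl b y) = sym_incl scl b (br x y)"
      by (simp add: \<iota>_def)
  qed
  moreover have "P = Q" if P: "poisson_extension scl br b P" and Q: "poisson_extension scl br b Q" for P Q
  proof (intro ext)
    fix F G
    interpret S: vector_space smul by (rule vector_space_smul)
    have one: "R F 1 = 0" if "poisson_extension scl br b R" for R F
    proof -
      have "R F (1 * 1) = R F 1 * 1 + 1 * R F 1"
        using that unfolding poisson_extension_def by blast
      then show ?thesis by simp
    qed
    have zero: "R F 0 = 0" if "poisson_extension scl br b R" for R F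
    proof -
      have "R F (0 + 0) = R F 0 + R F 0" using that unfolding poisson_extension_def by blast
      then show ?thesis by simp
    qed
    have skew: "R F G = - R G F" if "poisson_extension scl br b R" for R F G
    proof -
      have "R (F + G) (F + G) = 0" "R F F = 0" "R G G = 0"
        using that unfolding poisson_extension_def by blast+
      moreover have "R (F + G) (F + G) = (R F F + R F G) + (R G F + R G G)"
        using that unfolding poisson_extension_def by metis
      ultimately show ?thesis by (simp add: add_eq_0_iff)
    qed
    have alg: "is_subalgebra {G. P F G = Q F G}" for F
      unfolding is_subalgebra_def S.subspace_def
      using P Q one[OF P] one[OF Q] zero[OF P] zero[OF Q] by (auto simp: poisson_extension_def)
    have vars: "P (var i) (var j) = Q (var i) (var j)" for i j
    proof -
      have "R (\<iota> (b i)) (\<iota> (b j)) = \<iota> (br (b i) (b j))" if "poisson_extension scl br b R" for R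
        using that unfolding poisson_extension_def \<iota>_def by blast
      from this[OF P] this[OF Q] show ?thesis by (simp add: \<iota>_basis)
    qed
    have "P (var i) G = Q (var i) G" for i G
      using subalgebra_vars[OF alg[of "var i"]] vars by blast
    then have "P F (var i) = Q F (var i)" for F i
      using skew[OF P] skew[OF Q] by metis
    then show "P F G = Q F G" using subalgebra_vars[OF alg[of F]] by blast
  qed
  ultimately show ?thesis by blast
qed


section \<open>Convergence of the exponential\<close>

lemma exp_converges_nilpotent:
  fixes D :: "('x, 'k::field_char_0) mpoly \<Rightarrow> ('x, 'k) mpoly"
  assumes "absolute_value av" and "\<And>F. \<exists>n. \<forall>m\<ge>n. (D ^^ m) F = 0"
  shows "exp_converges av D"
  unfolding exp_converges_def exp_sums_def
proof (intro allI)
  fix s F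
  obtain n where n: "\<And>m. m \<ge> n \<Longrightarrow> (D ^^ m) F = 0" using assms(2) by blast
  have eq: "(\<Sum>k<N. smul (s ^ k / fact k) ((D ^^ k) F)) = (\<Sum>k<n. smul (s ^ k / fact k) ((D ^^ k) F))"
    if "N \<ge> n" for N
    using that n by (intro sum.mono_neutral_right) (auto simp: smul_simps)
  have "av 0 = 0" using assms(1) by (simp add: absolute_value_def)
  have ev: "av (Poly_Mapping.lookup ((\<Sum>k<N. smul (s ^ k / fact k) ((D ^^ k) F)) -
      (\<Sum>k<n. smul (s ^ k / fact k) ((D ^^ k) F))) m) = 0" if "N \<ge> n" for m N
    unfolding eq[OF that] using \<open>av 0 = 0\<close> by simp
  show "\<exists>G. \<forall>m. (\<lambda>N. av (Poly_Mapping.lookup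
      ((\<Sum>k<N. smul (s ^ k / fact k) ((D ^^ k) F)) - G) m)) \<longlonglongrightarrow> 0"
  proof (intro exI allI tendsto_eventually)
    show "\<forall>\<^sub>F N in sequentially. av (Poly_Mapping.lookup
        ((\<Sum>k<N. smul (s ^ k / fact k) ((D ^^ k) F)) -
         (\<Sum>k<n. smul (s ^ k / fact k) ((D ^^ k) F))) m) = 0" for m
      using ev by (rule eventually_sequentiallyI)
  qed
qed

lemma exp_converges_norm:
  fixes D :: "('x, 'k::{real_normed_field, banach}) mpoly \<Rightarrow> ('x, 'k) mpoly"
  assumes lin: "Vector_Spaces.linear smul smul D" and fin: "locally_finite_dim smul D"
  shows "exp_converges norm D"
  unfolding exp_converges_def exp_sums_def
proof (intro allI)
  fix s :: 'k and F
  interpret Vector_Spaces.linear smul smul D by (rule lin)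
  define V where "V = {(D ^^ n) F |n. True}"
  obtain B0 where fin0: "finite B0" and "vs1.span V \<subseteq> vs1.span B0"
    using fin[unfolded locally_finite_dim_def, THEN spec, of F] unfolding V_def by (elim exE conjE)
  then have B0: "finite B0" "V \<subseteq> vs1.span B0"
    using vs1.span_superset[of V] by (auto intro: fin0)
  obtain B where B: "B \<subseteq> V" "vs1.independent B" "V \<subseteq> vs1.span B"
    by (rule vs1.maximal_independent_subset)
  have finB: "finite B" using vs1.independent_span_bound[OF B0(1) B(2) order.trans[OF B(1) B0(2)]] by (rule conjunct1)
  have "D v \<in> vs1.span B" if v: "v \<in> B" for v
  proof -
    obtain n where "v = (D ^^ n) F" using v B(1) by (auto simp: V_def)
    then have "D v = (D ^^ Suc n) F" by simp
    then have "D v \<in> V" unfolding V_def by blast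
    then show ?thesis using B(3) by blast
  qed
  then have "\<forall>v\<in>B. \<exists>u. D v = (\<Sum>w\<in>B. smul (u w) w)"
    unfolding vs1.span_finite[OF finB] by auto
  then obtain a where a: "\<And>v. v \<in> B \<Longrightarrow> D v = (\<Sum>w\<in>B. smul (a v w) w)" by metis
  have "F \<in> V" unfolding V_def by (auto intro: exI[of _ 0])
  then obtain x0 where x0: "F = (\<Sum>w\<in>B. smul (x0 w) w)"
    using B(3) unfolding vs1.span_finite[OF finB] by auto
  define x where "x = rec_nat x0 (\<lambda>_ y w. \<Sum>v\<in>B. y v * a v w)"
  have x_simps: "x 0 = x0" "x (Suc n) = (\<lambda>w. \<Sum>v\<in>B. x n v * a v w)" for n
    by (simp_all add: x_def)
  have D_pow: "(D ^^ n) F = (\<Sum>w\<in>B. smul (x n w) w)" for n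
  proof (induction n)
    case 0
    then show ?case using x0 by (simp add: x_simps)
  next
    case (Suc n)
    have "(D ^^ Suc n) F = (\<Sum>v\<in>B. smul (x n v) (\<Sum>w\<in>B. smul (a v w) w))"
      using Suc a by (simp add: sum scale)
    also have "\<dots> = (\<Sum>v\<in>B. \<Sum>w\<in>B. smul (x n v * a v w) w)"
      by (simp add: vs1.scale_sum_right)
    also have "\<dots> = (\<Sum>w\<in>B. \<Sum>v\<in>B. smul (x n v * a v w) w)" by (rule sum.swap)
    finally show ?case by (simp add: x_simps vs1.scale_sum_left)
  qed
  define M where "M = (\<Sum>v\<in>B. \<Sum>w\<in>B. norm (a v w))"
  define C where "C = (\<Sum>v\<in>B. norm (x0 v))"
  have row: "(\<Sum>w\<in>B. norm (a v w)) \<le> M" if "v \<in> B" for v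
    unfolding M_def using that finB by (intro member_le_sum) (auto intro: sum_nonneg)
  have bound: "(\<Sum>w\<in>B. norm (x n w)) \<le> C * M ^ n" for n
  proof (induction n)
    case 0
    then show ?case by (simp add: C_def x_simps)
  next
    case (Suc n)
    have "(\<Sum>w\<in>B. norm (x (Suc n) w)) \<le> (\<Sum>w\<in>B. \<Sum>v\<in>B. norm (x n v) * norm (a v w))"
      unfolding x_simps by (intro sum_mono order.trans[OF norm_sum]) (simp add: norm_mult)
    also have "\<dots> = (\<Sum>v\<in>B. norm (x n v) * (\<Sum>w\<in>B. norm (a v w)))"
      by (subst sum.swap) (simp add: sum_distrib_left)
    also have "\<dots> \<le> (\<Sum>v\<in>B. norm (x n v) * M)"
      by (intro sum_mono mult_left_mono row) auto
    also have "\<dots> = (\<Sum>v\<in>B. norm (x n v)) * M" by (simp add: sum_distrib_right)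
    also have "\<dots> \<le> C * M ^ n * M"
      using Suc by (intro mult_right_mono) (auto simp: M_def intro!: sum_nonneg)
    finally show ?case by (simp add: mult_ac)
  qed
  have summ: "summable (\<lambda>n. s ^ n / fact n * x n w)" if "w \<in> B" for w
  proof (rule summable_comparison_test')
    show "summable (\<lambda>n. C * (inverse (fact n) * (norm s * M) ^ n))"
      by (intro summable_mult summable_exp)
    fix n :: nat
    have "norm (x n w) \<le> C * M ^ n"
      using member_le_sum[of w B "\<lambda>w. norm (x n w)"] that finB bound[of n] by force
    then have "norm (s ^ n / fact n) * norm (x n w) \<le> norm (s ^ n / fact n) * (C * M ^ n)"
      by (intro mult_left_mono) auto
    then show "norm (s ^ n / fact n * x n w) \<le> C * (inverse (fact n) * (norm s * M) ^ n)"
      by (simp add: norm_mult norm_divide norm_power power_mult_distrib field_simps)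
  qed
  define G where "G = (\<Sum>w\<in>B. smul (suminf (\<lambda>n. s ^ n / fact n * x n w)) w)"
  have "(\<lambda>N. norm (Poly_Mapping.lookup ((\<Sum>n<N. smul (s ^ n / fact n) ((D ^^ n) F)) - G) m)) \<longlonglongrightarrow> 0"
    for m
  proof -
    have "Poly_Mapping.lookup (\<Sum>n<N. smul (s ^ n / fact n) ((D ^^ n) F)) m =
        (\<Sum>w\<in>B. (\<Sum>n<N. s ^ n / fact n * x n w) * Poly_Mapping.lookup w m)" for N
      unfolding D_pow lookup_sum lookup_smul sum_distrib_left sum_distrib_right
      by (subst sum.swap) (simp add: mult.assoc)
    moreover have "(\<lambda>N. \<Sum>w\<in>B. (\<Sum>n<N. s ^ n / fact n * x n w) * Poly_Mapping.lookup w m)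
        \<longlonglongrightarrow> (\<Sum>w\<in>B. suminf (\<lambda>n. s ^ n / fact n * x n w) * Poly_Mapping.lookup w m)"
      by (intro tendsto_sum tendsto_mult_right summable_LIMSEQ summ)
    ultimately have "(\<lambda>N. Poly_Mapping.lookup (\<Sum>n<N. smul (s ^ n / fact n) ((D ^^ n) F)) m)
        \<longlonglongrightarrow> Poly_Mapping.lookup G m"
      by (simp add: G_def lookup_sum lookup_smul)
    from tendsto_norm_zero[OF LIM_zero[OF this]] show ?thesis by (simp add: lookup_minus)
  qed
  then show "\<exists>G. \<forall>m. (\<lambda>N. norm (Poly_Mapping.lookup
      ((\<Sum>n<N. smul (s ^ n / fact n) ((D ^^ n) F)) - G) m)) \<longlonglongrightarrow> 0"
    by blast
qed

end

theory Submission
  imports Defs "HOL-Computational_Algebra.Polynomial"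
begin

text \<open>Transporting a bracket by the invertible map \<open>e\<^bsup>sD\<^esup>\<close> transports its centre, so the centre
  of \<open>{ , }\<^bsub>(s)\<^esub>\<close> is \<open>e\<^bsup>sD\<^esup>(Z)\<close>, where \<open>Z\<close> is the Poisson centre (\<open>centre_exp_transport\<close>). It is
  therefore enough that, for each \<open>z\<close> in \<open>Z\<close>, the orbits \<open>{e\<^bsup>sD\<^esup> z | s}\<close> and \<open>{D\<^sup>n z | n}\<close> span the
  same vector space (\<open>span_exp_orbit\<close>).

  Spans are compared by duality: a vector outside a subspace is detected by a linear functional
  \<open>\<phi>\<close> vanishing on the subspace. Local finite-dimensionality confines the powers \<open>D\<^sup>n z\<close> to
  finitely many monomials, and so \<open>\<phi>\<close> may be applied termwise (\<open>functional_exp_sums\<close>):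
  \<open>\<phi>(e\<^bsup>sD\<^esup> z) = \<Sum>\<^sub>n \<phi>(D\<^sup>n z)/n! s\<^sup>n\<close>. If all coefficients on the right vanish, so does the left side
  for every \<open>s\<close>. Conversely, if the left side vanishes for every \<open>s\<close>, then so do the coefficients,
  by the identity theorem for everywhere convergent power series (\<open>power_series_identity\<close>).

  The remaining work is analytic and takes place over a field with an arbitrary, possibly
  incomplete, absolute value. What replaces completeness is that a series \<open>\<Sum>\<^sub>n c\<^sub>n t\<^sup>n\<close>
  converging for all \<open>t\<close> has coefficients decaying faster than every geometric sequence
  (\<open>entire_series_decay\<close>). This yields both the identity theorem and
  \<open>e\<^bsup>sD\<^esup> e\<^bsup>-sD\<^esup> = id\<close>.\<close>


section \<open>Series over a field with an absolute value\<close>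

locale valued_field =
  fixes av :: "'k::field_char_0 \<Rightarrow> real"
  assumes absolute_value: "absolute_value av"
begin

lemma av_nonneg [simp]: "av x \<ge> 0"
  and av_eq_0_iff [simp]: "av x = 0 \<longleftrightarrow> x = 0"
  and av_mult: "av (x * y) = av x * av y"
  and av_triangle: "av (x + y) \<le> av x + av y"
  using absolute_value by (auto simp: absolute_value_def)

lemma av_0 [simp]: "av 0 = 0"
  by simp

lemma av_1 [simp]: "av 1 = 1"
  using av_mult[of 1 1] av_eq_0_iff[of 1] by (auto simp del: av_eq_0_iff)

lemma av_minus [simp]: "av (- x) = av x"
proof -
  have "av (- 1) * av (- 1) = 1"
    using av_mult[of "- 1" "- 1"] by simp
  then have "av (- 1) = 1"
    using av_nonneg[of "- 1"] by (simp add: square_eq_1_iff)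
  then show ?thesis
    using av_mult[of "- 1" x] by simp
qed

lemma av_minus_commute: "av (x - y) = av (y - x)"
  using av_minus[of "x - y"] by simp

lemma av_diff_triangle: "av (x - z) \<le> av (x - y) + av (y - z)"
  using av_triangle[of "x - y" "y - z"] by simp

lemma av_power: "av (x ^ n) = av x ^ n"
  by (induction n) (simp_all add: av_mult)

lemma av_inverse: "av (inverse x) = inverse (av x)"
proof (cases "x = 0")
  case False
  then have "av x * av (inverse x) = 1"
    using av_mult[of x "inverse x"] by simp
  then show ?thesis by (simp add: inverse_unique)
qed simp

lemma av_sum: "av (sum f A) \<le> (\<Sum>a\<in>A. av (f a))"
proof (induction A rule: infinite_finite_induct)
  case (insert a A)
  then show ?case using av_triangle[of "f a" "sum f A"] by simp
qed simp_all

lemma av_of_nat: "av (of_nat n) \<le> real n"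
proof (induction n)
  case (Suc n)
  then show ?case using av_triangle[of 1 "of_nat n"] by simp
qed simp

definition av_sums :: "(nat \<Rightarrow> 'k) \<Rightarrow> 'k \<Rightarrow> bool" where
  "av_sums c x \<longleftrightarrow> (\<lambda>N. av ((\<Sum>n<N. c n) - x)) \<longlonglongrightarrow> 0"

lemma av_sums_unique:
  assumes "av_sums c x" "av_sums c y"
  shows "x = y"
proof -
  have "(\<lambda>N. av ((\<Sum>n<N. c n) - x) + av ((\<Sum>n<N. c n) - y)) \<longlonglongrightarrow> 0 + 0"
    using assms unfolding av_sums_def by (rule tendsto_add)
  moreover have "av (x - y) \<le> av ((\<Sum>n<N. c n) - x) + av ((\<Sum>n<N. c n) - y)" for N
    using av_diff_triangle[of x y "\<Sum>n<N. c n"] by (simp add: av_minus_commute[of x])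
  ultimately have "av (x - y) \<le> 0"
    by (intro LIMSEQ_le_const[where X = "\<lambda>N. av ((\<Sum>n<N. c n) - x) + av ((\<Sum>n<N. c n) - y)"]) auto
  then have "av (x - y) = 0"
    using av_nonneg[of "x - y"] by (rule order.antisym)
  then show ?thesis by simp
qed

lemma av_sums_imp_tendsto_0:
  assumes "av_sums c x"
  shows "(\<lambda>n. av (c n)) \<longlonglongrightarrow> 0"
proof (rule tendsto_sandwich[OF _ _ tendsto_const])
  show "\<forall>\<^sub>F n in sequentially. av (c n) \<le> av ((\<Sum>i<Suc n. c i) - x) + av ((\<Sum>i<n. c i) - x)"
  proof (intro always_eventually allI)
    fix n
    have "c n = (\<Sum>i<Suc n. c i) - (\<Sum>i<n. c i)" by simp
    then show "av (c n) \<le> av ((\<Sum>i<Suc n. c i) - x) + av ((\<Sum>i<n. c i) - x)"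
      using av_diff_triangle[of "\<Sum>i<Suc n. c i" "\<Sum>i<n. c i" x]
      by (metis av_minus_commute)
  qed
  have lim: "(\<lambda>n. av ((\<Sum>i<n. c i) - x)) \<longlonglongrightarrow> 0"
    using assms by (simp add: av_sums_def)
  show "(\<lambda>n. av ((\<Sum>i<Suc n. c i) - x) + av ((\<Sum>i<n. c i) - x)) \<longlonglongrightarrow> 0"
    using tendsto_add[OF LIMSEQ_Suc[OF lim] lim] by simp
qed (auto intro: always_eventually)

lemma av_sums_linear_combination:
  assumes "\<And>i. i \<in> I \<Longrightarrow> av_sums (c i) (x i)"
  shows "av_sums (\<lambda>n. \<Sum>i\<in>I. k i * c i n) (\<Sum>i\<in>I. k i * x i)"
  unfolding av_sums_def
proof (rule tendsto_sandwich[OF _ _ tendsto_const])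
  show "\<forall>\<^sub>F N in sequentially. av ((\<Sum>n<N. \<Sum>i\<in>I. k i * c i n) - (\<Sum>i\<in>I. k i * x i))
      \<le> (\<Sum>i\<in>I. av (k i) * av ((\<Sum>n<N. c i n) - x i))"
  proof (intro always_eventually allI)
    fix N
    have "(\<Sum>n<N. \<Sum>i\<in>I. k i * c i n) - (\<Sum>i\<in>I. k i * x i) = (\<Sum>i\<in>I. k i * ((\<Sum>n<N. c i n) - x i))"
      by (subst sum.swap) (simp add: sum_distrib_left right_diff_distrib sum_subtractf)
    then show "av ((\<Sum>n<N. \<Sum>i\<in>I. k i * c i n) - (\<Sum>i\<in>I. k i * x i))
        \<le> (\<Sum>i\<in>I. av (k i) * av ((\<Sum>n<N. c i n) - x i))"
      using av_sum[of "\<lambda>i. k i * ((\<Sum>n<N. c i n) - x i)" I] by (simp add: av_mult)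
  qed
  show "(\<lambda>N. \<Sum>i\<in>I. av (k i) * av ((\<Sum>n<N. c i n) - x i)) \<longlonglongrightarrow> 0"
    using assms unfolding av_sums_def by (intro tendsto_null_sum tendsto_mult_right_zero) auto
qed (auto intro: always_eventually)

text \<open>If some nonzero \<open>x\<close> has absolute value other than 1, then large powers of \<open>x\<close> or of its inverse
  are small.\<close>

lemma trivial_or_arbitrarily_small:
  obtains (trivial) "\<And>x. x \<noteq> 0 \<Longrightarrow> av x = 1"
  | (small) "\<And>e. e > 0 \<Longrightarrow> \<exists>t. t \<noteq> 0 \<and> av t < e"
proof (cases "\<forall>x. x \<noteq> 0 \<longrightarrow> av x = 1")
  case False
  then obtain x where x: "x \<noteq> 0" "av x \<noteq> 1" by blast
  have "\<exists>t. t \<noteq> 0 \<and> av t < 1"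
  proof (cases "av x < 1")
    case False
    then have "av (inverse x) < 1"
      using x by (simp add: av_inverse inverse_less_1_iff)
    then show ?thesis using x by (intro exI[of _ "inverse x"]) simp
  qed (use x in blast)
  then obtain t where t: "t \<noteq> 0" "av t < 1" by blast
  have "\<exists>u. u \<noteq> 0 \<and> av u < e" if "e > 0" for e
    using real_arch_pow_inv[OF that t(2)] t by (metis av_power power_not_zero)
  then show ?thesis using small by blast
qed (use trivial in blast)

text \<open>The terms of a convergent series tend to 0, hence are bounded, and the absolute value of \<open>t\<close> can
  be made larger than any \<open>R\<close>. The exception is the trivial absolute value; there the terms at
  \<open>t = 1\<close> tend to 0 only if almost all coefficients vanish.\<close>

lemma entire_series_decay:
  assumes "\<And>t. \<exists>x. av_sums (\<lambda>n. c n * t ^ n) x"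
  shows "\<exists>C>0. \<forall>n. av (c n) * R ^ n \<le> C"
proof -
  have lim: "(\<lambda>n. av (c n) * av t ^ n) \<longlonglongrightarrow> 0" for t
    using assms[of t] av_sums_imp_tendsto_0 by (fastforce simp: av_mult av_power)
  have "Bseq (\<lambda>n. av (c n) * R ^ n)"
  proof (rule trivial_or_arbitrarily_small)
    assume triv: "\<And>x. x \<noteq> 0 \<Longrightarrow> av x = 1"
    have "\<forall>\<^sub>F n in sequentially. av (c n) < 1"
      using lim[of 1] by (auto dest: order_tendstoD(2)[where a = 1])
    then have "\<forall>\<^sub>F n in sequentially. av (c n) * R ^ n = 0"
    proof eventually_elim
      case (elim n)
      then show ?case using triv[of "c n"] by (cases "c n = 0") auto
    qed
    then show ?thesis by (intro convergent_imp_Bseq convergentI tendsto_eventually)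
  next
    assume small: "\<And>e. e > 0 \<Longrightarrow> \<exists>t. t \<noteq> 0 \<and> av t < e"
    have "inverse (\<bar>R\<bar> + 1) > 0" by simp
    then obtain t where t: "t \<noteq> 0" "av t < inverse (\<bar>R\<bar> + 1)"
      using small by blast
    have "av t > 0" using t(1) av_nonneg[of t] by (simp add: order.strict_iff_order)
    then have "\<bar>R\<bar> + 1 < av (inverse t)"
      using t(2) less_imp_inverse_less[of "av t" "inverse (\<bar>R\<bar> + 1)"] by (simp add: av_inverse)
    then have R: "\<bar>R\<bar> \<le> av (inverse t)" by simp
    show ?thesis
    proof (rule Bseq_eventually_mono)
      show "Bseq (\<lambda>n. av (c n) * av (inverse t) ^ n)"
        using lim convergent_imp_Bseq convergentI by blast
      show "\<forall>\<^sub>F n in sequentially. norm (av (c n) * R ^ n) \<le> norm (av (c n) * av (inverse t) ^ n)"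
        using R by (intro always_eventually allI)
          (auto simp: abs_mult power_abs intro!: mult_left_mono power_mono)
    qed
  qed
  then obtain C where "C > 0" "\<And>n. norm (av (c n) * R ^ n) \<le> C"
    by (elim BseqE) auto
  then show ?thesis by (metis abs_le_D1 real_norm_def)
qed

text \<open>If there are small nonzero \<open>t\<close>, the lowest nonvanishing term dominates the rest of the series at
  such a \<open>t\<close>. For the trivial absolute value the series is a polynomial with infinitely many
  zeros.\<close>

lemma power_series_identity:
  assumes "\<And>t. av_sums (\<lambda>n. c n * t ^ n) 0"
  shows "c n = 0"
proof (rule ccontr)
  assume "c n \<noteq> 0"
  define k where "k = (LEAST n. c n \<noteq> 0)"
  have k: "c k \<noteq> 0"
    unfolding k_def using \<open>c n \<noteq> 0\<close> by (rule LeastI)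
  have below: "c i = 0" if "i < k" for i
    using not_less_Least[OF that[unfolded k_def]] by simp
  obtain C where C: "C > 0" "\<And>n. av (c n) \<le> C"
    using entire_series_decay[of c 1] assms unfolding power_one mult_1_right by blast
  show False
  proof (rule trivial_or_arbitrarily_small)
    assume triv: "\<And>x. x \<noteq> 0 \<Longrightarrow> av x = 1"
    have "(\<lambda>n. av (c n)) \<longlonglongrightarrow> 0"
      using av_sums_imp_tendsto_0[OF assms[of 1]] by simp
    then have "\<forall>\<^sub>F n in sequentially. av (c n) < 1"
      by (auto dest: order_tendstoD(2)[where a = 1])
    then obtain N where "\<And>n. n \<ge> N \<Longrightarrow> av (c n) < 1"
      by (auto simp: eventually_sequentially)
    then have N: "c n = 0" if "n \<ge> N" for n
      using triv[of "c n"] that by force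
    \<comment> \<open>Almost all coefficients vanish, so the series is the polynomial function of \<open>p\<close>.\<close>
    define p where "p = (\<Sum>n<N. monom (c n) n)"
    have "poly p t = 0" for t
    proof -
      have "(\<Sum>n<M. c n * t ^ n) = poly p t" if "M \<ge> N" for M
        unfolding p_def poly_sum poly_monom
        using that N by (intro sum.mono_neutral_right) auto
      then have "\<forall>\<^sub>F M in sequentially. av ((\<Sum>n<M. c n * t ^ n) - 0) = av (poly p t)"
        by (intro eventually_sequentiallyI[of N]) simp
      then have "(\<lambda>M. av ((\<Sum>n<M. c n * t ^ n) - 0)) \<longlonglongrightarrow> av (poly p t)"
        by (rule tendsto_eventually)
      then have "av (poly p t) = 0"
        using assms[of t] unfolding av_sums_def by (rule LIMSEQ_unique)
      then show ?thesis by simp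
    qed
    then have "p = 0" using poly_all_0_iff_0 by blast
    moreover have "coeff p k = c k"
    proof -
      have "k < N" using N k by (meson not_less)
      then show ?thesis by (simp add: p_def coeff_sum)
    qed
    ultimately show False using k by simp
  next
    assume small: "\<And>e. e > 0 \<Longrightarrow> \<exists>t. t \<noteq> 0 \<and> av t < e"
    have ck: "av (c k) > 0" using k av_nonneg[of "c k"] av_eq_0_iff[of "c k"] by linarith
    \<comment> \<open>With \<open>r = av t\<close>, the terms beyond the \<open>k\<close>-th sum to at most \<open>C r\<^bsup>k+1\<^esup> / (1 - r) \<le> 2 C r\<^bsup>k+1\<^esup>\<close>;
      the choice of \<open>t\<close> makes this at most half of the \<open>k\<close>-th term.\<close>
    have "min (1 / 2) (av (c k) / (4 * C)) > 0" using ck C(1) by simp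
    then obtain t where t: "t \<noteq> 0" "av t < min (1 / 2) (av (c k) / (4 * C))" using small by blast
    define r where "r = av t"
    have r: "0 < r" "r < 1 / 2" "2 * C * r < av (c k) / 2"
    proof -
      show "0 < r" using t(1) av_nonneg[of t] av_eq_0_iff[of t] unfolding r_def by linarith
      show "r < 1 / 2" "2 * C * r < av (c k) / 2" using t(2) C(1) by (simp_all add: r_def field_simps)
    qed
    have tail: "av (\<Sum>n<N. c (n + Suc k) * t ^ (n + Suc k)) \<le> 2 * C * r * r ^ k" for N
    proof -
      have "av (\<Sum>n<N. c (n + Suc k) * t ^ (n + Suc k)) \<le> (\<Sum>n<N. C * r ^ Suc k * (1 / 2) ^ n)"
      proof (rule order.trans[OF av_sum], rule sum_mono)
        fix n
        have "av (c (n + Suc k) * t ^ (n + Suc k)) = av (c (n + Suc k)) * (r ^ Suc k * r ^ n)"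
          by (simp add: av_mult av_power r_def power_add)
        also have "\<dots> \<le> C * (r ^ Suc k * (1 / 2) ^ n)"
          using r C by (intro mult_mono mult_left_mono power_mono) auto
        finally show "av (c (n + Suc k) * t ^ (n + Suc k)) \<le> C * r ^ Suc k * (1 / 2) ^ n"
          by (simp add: mult_ac)
      qed
      also have "\<dots> = C * r ^ Suc k * (\<Sum>n<N. (1 / 2) ^ n)"
        by (simp add: sum_distrib_left)
      also have "\<dots> \<le> C * r ^ Suc k * 2"
        using r C by (intro mult_left_mono) (auto simp: sum_gp_strict)
      finally show ?thesis by (simp add: mult_ac)
    qed
    have "(av (c k) / 2) * r ^ k \<le> av ((\<Sum>n<N. c n * t ^ n) - 0)" if N: "N \<ge> Suc k" for N
    proof -
      obtain N' where N': "N = Suc k + N'" using le_Suc_ex[OF N] by blast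
      have "(\<Sum>n<k. c n * t ^ n) = 0"
        by (intro sum.neutral ballI) (simp add: below)
      moreover have "(\<Sum>n<N. c n * t ^ n) =
          (\<Sum>n<Suc k. c n * t ^ n) + (\<Sum>n<N'. c (n + Suc k) * t ^ (n + Suc k))"
        unfolding N' by (induction N') (simp_all add: add_ac)
      ultimately have "c k * t ^ k =
          (\<Sum>n<N. c n * t ^ n) + - (\<Sum>n<N'. c (n + Suc k) * t ^ (n + Suc k))" by simp
      then have "av (c k * t ^ k) \<le>
          av (\<Sum>n<N. c n * t ^ n) + av (- (\<Sum>n<N'. c (n + Suc k) * t ^ (n + Suc k)))"
        by (simp only: av_triangle)
      then have "av (c k) * r ^ k \<le> av (\<Sum>n<N. c n * t ^ n) + 2 * C * r * r ^ k"
        using tail[of N'] by (simp add: av_mult av_power r_def del: sum.lessThan_Suc)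
      moreover have "2 * C * r * r ^ k \<le> av (c k) / 2 * r ^ k"
        using r by (intro mult_right_mono) auto
      ultimately show ?thesis by simp
    qed
    then have "(av (c k) / 2) * r ^ k \<le> 0"
      using assms[of t] unfolding av_sums_def by (intro LIMSEQ_le_const) blast+
    moreover have "(av (c k) / 2) * r ^ k > 0" using r ck by simp
    ultimately show False by linarith
  qed
qed

text \<open>This is \<open>e\<^bsup>sD\<^esup> e\<^bsup>-sD\<^esup> F = F\<close> read off one coefficient at a time: \<open>a n\<close> stands for a coefficient of
  \<open>D\<^sup>n F\<close> and \<open>g i\<close> for the same coefficient of \<open>D\<^sup>i e\<^bsup>-sD\<^esup> F\<close>. In the double series with terms \<open>u i j\<close>,
  the terms with \<open>i + j = n\<close> add up to \<open>a n / n! (s - s)\<^sup>n\<close> by the binomial theorem, so only \<open>a 0\<close>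
  survives. The decay of \<open>a n / n!\<close> bounds the terms with \<open>i + j \<ge> M\<close>, which are what a
  rectangular partial sum contains beyond the triangle \<open>i + j < M\<close>.\<close>

lemma exponential_series_inverse:
  assumes entire: "\<And>t. \<exists>x. av_sums (\<lambda>n. a n / fact n * t ^ n) x"
    and g: "\<And>i. av_sums (\<lambda>j. a (i + j) / fact j * (- s) ^ j) (g i)"
  shows "av_sums (\<lambda>i. g i / fact i * s ^ i) (a 0)"
proof -
  \<comment> \<open>One factor 2 of 8 absorbs the binomial coefficients, which are at most \<open>2\<^bsup>i+j\<^esup>\<close>; the
    remaining 4 leaves \<open>4\<^bsup>-(i+j)\<^esup> = 2\<^bsup>-(i+j)\<^esup> 2\<^bsup>-(i+j)\<^esup>\<close>, where one factor is at most \<open>2\<^bsup>-M\<^esup>\<close> beyond the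
    triangle and the other makes the double series summable.\<close>
  define R where "R = 8 * (av s + 1)"
  obtain C where C: "C > 0" "\<And>n. av (a n / fact n) * R ^ n \<le> C"
    using entire_series_decay[of "\<lambda>n. a n / fact n" R] entire by auto
  define u where "u i j = s ^ i / fact i * (a (i + j) / fact j * (- s) ^ j)" for i j
  have u_bound: "av (u i j) \<le> C * ((1 / 4) ^ (i + j))" for i j
  proof -
    have "u i j = of_nat ((i + j) choose i) * (a (i + j) / fact (i + j)) * (s ^ i * (- s) ^ j)"
      unfolding u_def using binomial_fact[of i "i + j", where 'a = 'k] by (simp add: field_simps)
    then have "av (u i j) = av (of_nat ((i + j) choose i)) * av (a (i + j) / fact (i + j)) * av s ^ (i + j)"
      by (simp only: av_mult av_power av_minus power_add)
    also have "\<dots> \<le> 2 ^ (i + j) * av (a (i + j) / fact (i + j)) * (R / 8) ^ (i + j)"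
    proof (intro mult_mono power_mono)
      have "av (of_nat ((i + j) choose i)) \<le> real ((i + j) choose i)" by (rule av_of_nat)
      also have "\<dots> \<le> real (2 ^ (i + j))" by (subst of_nat_le_iff) (rule binomial_le_pow2)
      finally show "av (of_nat ((i + j) choose i)) \<le> 2 ^ (i + j)" by simp
    qed (auto simp: R_def)
    also have "\<dots> = av (a (i + j) / fact (i + j)) * R ^ (i + j) * (1 / 4) ^ (i + j)"
    proof -
      have "(2::real) ^ n * (R / 8) ^ n = R ^ n * (1 / 4) ^ n" for n
        by (simp flip: power_mult_distrib)
      then show ?thesis by (simp add: mult_ac)
    qed
    also have "\<dots> \<le> C * (1 / 4) ^ (i + j)"
      by (intro mult_right_mono C) auto
    finally show ?thesis .
  qed
  have estimate: "av ((\<Sum>i<M. g i / fact i * s ^ i) - a 0) \<le> 4 * C * (1 / 2) ^ M" if M: "M > 0" for M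
  proof -
    have partial: "av ((\<Sum>i<M. g i / fact i * s ^ i) - a 0) \<le>
        av ((\<Sum>j<N. \<Sum>i<M. u i j) - (\<Sum>i<M. g i / fact i * s ^ i)) + 4 * C * (1 / 2) ^ M"
      if N: "N \<ge> M" for N
    proof -
      define P where "P = {..<M} \<times> {..<N}"
      define T where "T = {(i, j). i + j < M}"
      have T: "T \<subseteq> P" "finite P" using N by (auto simp: T_def P_def)
      have "sum (case_prod u) T = (\<Sum>k<M. \<Sum>i\<le>k. u i (k - i))"
        unfolding T_def by (rule sum.triangle_reindex)
      also have "\<dots> = (\<Sum>k<M. if k = 0 then a 0 else 0)"
      proof (rule sum.cong)
        fix k
        have "(\<Sum>i\<le>k. u i (k - i)) = a k / fact k * (\<Sum>i\<le>k. of_nat (k choose i) * s ^ i * (- s) ^ (k - i))"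
          unfolding u_def sum_distrib_left
          by (intro sum.cong refl) (simp add: binomial_fact field_simps)
        also have "\<dots> = a k / fact k * (s + - s) ^ k"
          by (simp only: binomial_ring)
        finally show "(\<Sum>i\<le>k. u i (k - i)) = (if k = 0 then a 0 else 0)"
          by (simp add: power_0_left)
      qed simp
      also have "\<dots> = a 0" using M by simp
      finally have diag: "sum (case_prod u) T = a 0" .
      have "(\<Sum>j<N. \<Sum>i<M. u i j) = sum (case_prod u) P"
        unfolding P_def by (subst sum.swap) (simp add: sum.cartesian_product)
      also have "\<dots> = sum (case_prod u) (P - T) + a 0"
        using sum.subset_diff[OF T, of "case_prod u"] diag by simp
      finally have split: "(\<Sum>j<N. \<Sum>i<M. u i j) - a 0 = sum (case_prod u) (P - T)" by simp
      have "av (sum (case_prod u) (P - T)) \<le>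
          (\<Sum>(i, j)\<in>P - T. C * (1 / 2) ^ M * ((1 / 2) ^ i * (1 / 2) ^ j))"
      proof (rule order.trans[OF av_sum], rule sum_mono, clarify)
        fix i j assume ij: "(i, j) \<notin> T"
        have "(1 / 4 :: real) ^ (i + j) = (1 / 2) ^ (i + j) * (1 / 2) ^ (i + j)"
          by (simp flip: power_mult_distrib)
        also have "\<dots> \<le> (1 / 2) ^ M * (1 / 2) ^ (i + j)"
          using ij by (intro mult_right_mono power_decreasing) (auto simp: T_def)
        finally show "av (u i j) \<le> C * (1 / 2) ^ M * ((1 / 2) ^ i * (1 / 2) ^ j)"
          using order.trans[OF u_bound mult_left_mono] C(1)
          by (simp only: power_add mult.assoc less_imp_le)
      qed
      also have "\<dots> \<le> (\<Sum>(i, j)\<in>P. C * (1 / 2) ^ M * ((1 / 2) ^ i * (1 / 2) ^ j))"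
        using C(1) T(2) by (intro sum_mono2) auto
      also have "\<dots> = C * (1 / 2) ^ M * ((\<Sum>i<M. (1 / 2) ^ i) * (\<Sum>j<N. (1 / 2) ^ j))"
        unfolding P_def sum_product sum.cartesian_product
        by (simp only: sum_distrib_left case_prod_unfold)
      also have "\<dots> \<le> C * (1 / 2) ^ M * (2 * 2)"
        using C(1) by (intro mult_left_mono mult_mono) (auto simp: sum_gp_strict power_le_one)
      finally have "av ((\<Sum>j<N. \<Sum>i<M. u i j) - a 0) \<le> 4 * C * (1 / 2) ^ M"
        unfolding split by (simp add: mult_ac)
      then show ?thesis
        using av_diff_triangle[of "\<Sum>i<M. g i / fact i * s ^ i" "a 0" "\<Sum>j<N. \<Sum>i<M. u i j"]
        unfolding av_minus_commute[of "\<Sum>i<M. g i / fact i * s ^ i" "\<Sum>j<N. \<Sum>i<M. u i j"]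
        by linarith
    qed
    \<comment> \<open>For fixed \<open>M\<close>, let the width \<open>N\<close> of the rectangle tend to infinity.\<close>
    have "av_sums (\<lambda>j. \<Sum>i<M. u i j) (\<Sum>i<M. g i / fact i * s ^ i)"
      using av_sums_linear_combination[of "{..<M}" "\<lambda>i j. a (i + j) / fact j * (- s) ^ j" g
          "\<lambda>i. s ^ i / fact i"] g
      by (simp add: u_def mult.commute)
    then have "(\<lambda>N. av ((\<Sum>j<N. \<Sum>i<M. u i j) - (\<Sum>i<M. g i / fact i * s ^ i)) + 4 * C * (1 / 2) ^ M)
        \<longlonglongrightarrow> 0 + 4 * C * (1 / 2) ^ M"
      unfolding av_sums_def by (intro tendsto_add tendsto_const)
    then show ?thesis
      using partial by (intro LIMSEQ_le_const) auto
  qed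
  show ?thesis
    unfolding av_sums_def
  proof (rule tendsto_sandwich[OF _ _ tendsto_const])
    show "\<forall>\<^sub>F M in sequentially. av ((\<Sum>i<M. g i / fact i * s ^ i) - a 0) \<le> 4 * C * (1 / 2) ^ M"
      using estimate by (intro eventually_sequentiallyI[of 1]) simp
    show "(\<lambda>M. 4 * C * (1 / 2) ^ M) \<longlonglongrightarrow> 0"
      by (intro tendsto_mult_right_zero LIMSEQ_power_zero) simp
  qed (auto intro: always_eventually)
qed

end


section \<open>Linear functionals\<close>

lemma linear_mpoly_expand:
  assumes lin: "Vector_Spaces.linear smul (*) \<phi>"
    and K: "finite K" "Poly_Mapping.keys F \<subseteq> K"
  shows "\<phi> F = (\<Sum>m\<in>K. Poly_Mapping.lookup F m * \<phi> (Poly_Mapping.single m 1))"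
proof -
  interpret \<phi>: Vector_Spaces.linear smul "(*)" \<phi> by (rule lin)
  have "F = (\<Sum>m\<in>K. smul (Poly_Mapping.lookup F m) (Poly_Mapping.single m 1))"
    using K by (intro poly_mapping_eqI)
      (auto simp: smul_simps lookup_sum lookup_single when_def in_keys_iff sum.delta')
  then have "\<phi> F = \<phi> (\<Sum>m\<in>K. smul (Poly_Mapping.lookup F m) (Poly_Mapping.single m 1))" by (rule arg_cong)
  then show ?thesis by (simp add: \<phi>.sum \<phi>.scale)
qed

lemma vector_space_mult: "vector_space ((*) :: 'k::field \<Rightarrow> 'k \<Rightarrow> 'k)"
  by unfold_locales (simp_all add: algebra_simps)

text \<open>Extend a basis of the span of \<open>W\<close> by \<open>G\<close> and let \<open>\<phi>\<close> be the coordinate of \<open>G\<close>.\<close>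

lemma separating_functional:
  fixes G :: "('x, 'k::field) mpoly"
  assumes "G \<notin> module.span smul W"
  obtains \<phi> where "Vector_Spaces.linear smul (*) \<phi>" "\<And>w. w \<in> W \<Longrightarrow> \<phi> w = 0" "\<phi> G \<noteq> (0::'k)"
proof -
  interpret vector_space_pair "smul :: 'k \<Rightarrow> ('x, 'k) mpoly \<Rightarrow> _" "(*) :: 'k \<Rightarrow> 'k \<Rightarrow> 'k"
    by (intro vector_space_pair.intro vector_space_smul vector_space_mult)
  obtain B where B: "B \<subseteq> W" "vs1.independent B" "W \<subseteq> vs1.span B"
    by (rule vs1.maximal_independent_subset)
  have "G \<notin> vs1.span B" using assms vs1.span_mono[OF B(1)] by blast
  then have ind: "vs1.independent (insert G B)" using B(2) by (simp add: vs1.independent_insert)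
  obtain \<phi> where \<phi>: "Vector_Spaces.linear smul (*) \<phi>"
      "\<forall>x\<in>insert G B. \<phi> x = (if x = G then 1 else 0)"
    using linear_independent_extend[OF ind, of "\<lambda>x. if x = G then 1 else 0"] by blast
  have "G \<notin> B" using \<open>G \<notin> vs1.span B\<close> vs1.span_superset by blast
  show ?thesis
  proof (rule that[OF \<phi>(1)])
    show "\<phi> w = 0" if "w \<in> W" for w
    proof (rule linear_eq_0_on_span[OF \<phi>(1)])
      show "w \<in> vs1.span B" using B(3) that by (rule subsetD)
      show "\<phi> x = 0" if "x \<in> B" for x
        using \<phi>(2) that \<open>G \<notin> B\<close> by (metis insertCI)
    qed
    show "\<phi> G \<noteq> 0" using \<phi>(2) by simp
  qed
qed


section \<open>The exponential of a locally finite-dimensional operator\<close>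

locale exponentiable = valued_field av
  for av :: "'k::field_char_0 \<Rightarrow> real" +
  fixes D :: "('x, 'k) mpoly \<Rightarrow> ('x, 'k) mpoly"
  assumes linear_D: "Vector_Spaces.linear smul smul D"
    and locally_finite: "locally_finite_dim smul D"
    and converges: "exp_converges av D"
begin

sublocale D: Vector_Spaces.linear smul smul D
  by (rule linear_D)

lemma linear_D_power: "Vector_Spaces.linear smul smul (D ^^ n)"
proof (induction n)
  case 0
  then show ?case by (simp add: D.vs1.linear_ident id_def)
next
  case (Suc n)
  then show ?case using Vector_Spaces.linear_compose[OF Suc linear_D] by (simp add: o_def)
qed

text \<open>A finite spanning set of the orbit involves only finitely many monomials. This is the form in
  which local finite-dimensionality enters.\<close>

lemma keys_orbit_bounded:
  obtains K where "finite K" "\<And>n. Poly_Mapping.keys ((D ^^ n) F) \<subseteq> K"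
proof -
  obtain B where B: "finite B" "D.vs1.span {(D ^^ n) F |n. True} \<subseteq> D.vs1.span B"
    using locally_finite unfolding locally_finite_dim_def by blast
  define K where "K = (\<Union>b\<in>B. Poly_Mapping.keys b)"
  have "D.vs1.subspace {G. \<forall>m. m \<notin> K \<longrightarrow> Poly_Mapping.lookup G m = 0}"
    by (simp add: D.vs1.subspace_def lookup_add lookup_smul)
  then have "D.vs1.span B \<subseteq> {G. \<forall>m. m \<notin> K \<longrightarrow> Poly_Mapping.lookup G m = 0}"
    by (intro D.vs1.span_minimal) (auto simp: K_def in_keys_iff)
  also have "\<dots> = {G. Poly_Mapping.keys G \<subseteq> K}"
    by (auto simp: in_keys_iff)
  finally have "D.vs1.span B \<subseteq> {G. Poly_Mapping.keys G \<subseteq> K}" .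
  moreover have "(D ^^ n) F \<in> D.vs1.span B" for n
    by (rule subsetD[OF B(2)], rule D.vs1.span_base) blast
  ultimately have "Poly_Mapping.keys ((D ^^ n) F) \<subseteq> K" for n by blast
  moreover have "finite K" using B(1) by (simp add: K_def)
  ultimately show ?thesis using that by blast
qed

lemma exp_sums_iff:
  "exp_sums av s D F G \<longleftrightarrow>
    (\<forall>m. av_sums (\<lambda>n. Poly_Mapping.lookup ((D ^^ n) F) m / fact n * s ^ n) (Poly_Mapping.lookup G m))"
  by (simp add: exp_sums_def av_sums_def lookup_minus lookup_sum lookup_smul mult.commute)

lemma exp_map_sums: "exp_sums av s D F (exp_map av s D F)"
proof -
  have "G = H" if "exp_sums av s D F G" "exp_sums av s D F H" for G H
    using that unfolding exp_sums_iff by (intro poly_mapping_eqI) (blast intro: av_sums_unique)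
  then have "\<exists>!G. exp_sums av s D F G"
    using converges unfolding exp_converges_def by blast
  then show ?thesis unfolding exp_map_def by (rule theI')
qed

lemma exp_map_eqI:
  assumes "exp_sums av s D F G"
  shows "exp_map av s D F = G"
  using assms exp_map_sums[of s F] unfolding exp_sums_iff
  by (intro poly_mapping_eqI) (blast intro: av_sums_unique)

text \<open>On polynomials in a fixed finite set of monomials, \<open>\<phi>\<close> is a finite linear combination of
  coefficient functionals, and therefore respects coefficientwise convergence.\<close>

lemma functional_exp_sums:
  assumes lin: "Vector_Spaces.linear smul (*) \<phi>"
  shows "av_sums (\<lambda>n. \<phi> ((D ^^ n) F) / fact n * s ^ n) (\<phi> (exp_map av s D F))"
proof -
  obtain K where K: "finite K" "\<And>n. Poly_Mapping.keys ((D ^^ n) F) \<subseteq> K"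
    using keys_orbit_bounded[of F] by blast
  define L where "L = K \<union> Poly_Mapping.keys (exp_map av s D F)"
  have L: "finite L" "Poly_Mapping.keys ((D ^^ n) F) \<subseteq> L" "Poly_Mapping.keys (exp_map av s D F) \<subseteq> L" for n
    using K by (auto simp: L_def)
  have "av_sums (\<lambda>n. \<Sum>m\<in>L. \<phi> (Poly_Mapping.single m 1) * (Poly_Mapping.lookup ((D ^^ n) F) m / fact n * s ^ n))
      (\<Sum>m\<in>L. \<phi> (Poly_Mapping.single m 1) * Poly_Mapping.lookup (exp_map av s D F) m)"
    using exp_map_sums[of s F] unfolding exp_sums_iff by (intro av_sums_linear_combination) blast
  then show ?thesis
    unfolding linear_mpoly_expand[OF lin L(1,2)] linear_mpoly_expand[OF lin L(1,3)]
    by (simp add: sum_distrib_left sum_distrib_right sum_divide_distrib mult_ac)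
qed

lemma exp_map_inverse: "exp_map av s D (exp_map av (- s) D F) = F"
proof (rule exp_map_eqI, unfold exp_sums_iff, intro allI)
  fix m
  let ?c = "\<lambda>n. Poly_Mapping.lookup ((D ^^ n) F) m"
  have "av_sums (\<lambda>i. Poly_Mapping.lookup ((D ^^ i) (exp_map av (- s) D F)) m / fact i * s ^ i) (?c 0)"
  proof (rule exponential_series_inverse)
    show "\<exists>x. av_sums (\<lambda>n. ?c n / fact n * t ^ n) x" for t
      using exp_map_sums[of t F] unfolding exp_sums_iff by blast
    fix i
    interpret i: Vector_Spaces.linear smul smul "D ^^ i" by (rule linear_D_power)
    have "Vector_Spaces.linear smul (*) (\<lambda>F. Poly_Mapping.lookup ((D ^^ i) F) m)"
      by (simp add: Vector_Spaces.linear_iff vector_space_smul vector_space_mult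
          i.add i.scale lookup_add lookup_smul)
    from functional_exp_sums[OF this, of F "- s"]
    show "av_sums (\<lambda>j. ?c (i + j) / fact j * (- s) ^ j)
        (Poly_Mapping.lookup ((D ^^ i) (exp_map av (- s) D F)) m)"
      by (simp add: funpow_add)
  qed
  then show "av_sums (\<lambda>i. Poly_Mapping.lookup ((D ^^ i) (exp_map av (- s) D F)) m / fact i * s ^ i)
      (Poly_Mapping.lookup F m)" by simp
qed

lemma exp_map_0 [simp]: "exp_map av s D 0 = 0"
proof (rule exp_map_eqI)
  have "(D ^^ n) 0 = 0" for n by (induction n) (simp_all add: D.zero)
  then show "exp_sums av s D 0 0" by (simp add: exp_sums_def smul_simps)
qed

text \<open>\<open>F\<close> is central for the transported operation iff \<open>e\<^bsup>-sD\<^esup> F\<close> is central for \<open>\<psi>\<close>: the outer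
  exponential has kernel 0, and \<open>e\<^bsup>-sD\<^esup> H\<close> runs over all polynomials as \<open>H\<close> does.\<close>

lemma centre_exp_transport:
  "centre (exp_transport av s D \<psi>) = exp_map av s D ` centre \<psi>"
proof -
  have inv: "exp_map av (- s) D (exp_map av s D F) = F" for F
    using exp_map_inverse[of "- s" F] by simp
  have eq0: "exp_map av s D F = 0 \<longleftrightarrow> F = 0" for F
    using inv[of F] by auto
  have "F \<in> centre (exp_transport av s D \<psi>) \<longleftrightarrow> exp_map av (- s) D F \<in> centre \<psi>" for F
    unfolding centre_def exp_transport_def mem_Collect_eq eq0 by (metis inv)
  then show ?thesis by (force simp: inv exp_map_inverse image_iff)
qed

text \<open>A functional \<open>\<phi>\<close> kills all \<open>D\<^sup>n F\<close> iff it kills all \<open>e\<^bsup>sD\<^esup> F\<close>, because the numbers \<open>\<phi>(D\<^sup>n F)/n!\<close> are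
  the coefficients of the power series \<open>s \<mapsto> \<phi>(e\<^bsup>sD\<^esup> F)\<close>.\<close>

lemma span_exp_orbit:
  "module.span smul (range (\<lambda>s. exp_map av s D F)) = module.span smul (range (\<lambda>n. (D ^^ n) F))"
proof (rule subset_antisym)
  have "exp_map av s D F \<in> D.vs1.span (range (\<lambda>n. (D ^^ n) F))" for s
  proof (rule ccontr)
    assume "exp_map av s D F \<notin> D.vs1.span (range (\<lambda>n. (D ^^ n) F))"
    then obtain \<phi> where \<phi>: "Vector_Spaces.linear smul (*) \<phi>" "\<And>n. \<phi> ((D ^^ n) F) = 0"
        "\<phi> (exp_map av s D F) \<noteq> 0"
      by (elim separating_functional) blast
    have "av_sums (\<lambda>n. 0) (\<phi> (exp_map av s D F))"
      using functional_exp_sums[OF \<phi>(1), of F s] by (simp add: \<phi>(2))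
    moreover have "av_sums (\<lambda>n. 0) 0" by (simp add: av_sums_def)
    ultimately show False using \<phi>(3) av_sums_unique by blast
  qed
  then show "D.vs1.span (range (\<lambda>s. exp_map av s D F)) \<subseteq> D.vs1.span (range (\<lambda>n. (D ^^ n) F))"
    by (intro D.vs1.span_minimal) auto
  have "(D ^^ n) F \<in> D.vs1.span (range (\<lambda>s. exp_map av s D F))" for n
  proof (rule ccontr)
    assume "(D ^^ n) F \<notin> D.vs1.span (range (\<lambda>s. exp_map av s D F))"
    then obtain \<phi> where \<phi>: "Vector_Spaces.linear smul (*) \<phi>" "\<And>s. \<phi> (exp_map av s D F) = 0"
        "\<phi> ((D ^^ n) F) \<noteq> 0"
      by (elim separating_functional) blast
    \<comment> \<open>The power series \<open>s \<mapsto> \<phi>(e\<^bsup>sD\<^esup> F)\<close> vanishes identically.\<close>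
    have "\<phi> ((D ^^ n) F) / fact n = 0"
    proof (rule power_series_identity)
      show "av_sums (\<lambda>n. \<phi> ((D ^^ n) F) / fact n * t ^ n) 0" for t
        using functional_exp_sums[OF \<phi>(1), of F t] by (simp add: \<phi>(2))
    qed
    then show False using \<phi>(3) by simp
  qed
  then show "D.vs1.span (range (\<lambda>n. (D ^^ n) F)) \<subseteq> D.vs1.span (range (\<lambda>s. exp_map av s D F))"
    by (intro D.vs1.span_minimal) auto
qed

end


section \<open>The two subalgebras\<close>

lemma is_subalgebra_generated: "is_subalgebra (generated_subalgebra X)"
proof -
  interpret vector_space "smul :: 'b \<Rightarrow> ('a, 'b) mpoly \<Rightarrow> _" by (rule vector_space_smul)
  show ?thesis
    unfolding generated_subalgebra_def
    by (rule hull_in) (auto simp: is_subalgebra_def subspace_def)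
qed

lemma span_subset_generated_subalgebra:
  assumes "Y \<subseteq> X"
  shows "module.span smul Y \<subseteq> generated_subalgebra X"
proof -
  interpret vector_space "smul :: 'b \<Rightarrow> ('a, 'b) mpoly \<Rightarrow> _" by (rule vector_space_smul)
  have "X \<subseteq> generated_subalgebra X"
    unfolding generated_subalgebra_def by (rule hull_subset)
  then show ?thesis
    using assms is_subalgebra_generated[of X] by (intro span_minimal) (auto simp: is_subalgebra_def)
qed

lemma generated_subalgebra_subsetI:
  assumes "X \<subseteq> generated_subalgebra Y"
  shows "generated_subalgebra X \<subseteq> generated_subalgebra Y"
  using hull_minimal[of X _ is_subalgebra, OF assms is_subalgebra_generated]
  by (simp add: generated_subalgebra_def)

theorem theorem4p2:
  fixes scl :: "'k::field_char_0 \<Rightarrow> 'q::ab_group_add \<Rightarrow> 'q"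
    and br :: "'q \<Rightarrow> 'q \<Rightarrow> 'q"
    and b :: "'i::finite \<Rightarrow> 'q"
    and av :: "'k \<Rightarrow> real"
    and D :: "('i, 'k) mpoly \<Rightarrow> ('i, 'k) mpoly"
  assumes "lie_algebra scl br"
    and "indexed_basis scl b"
    and "algebraic_lie_algebra scl br"
    and "near_derivation smul (poisson scl br b) D"
    and "locally_finite_dim smul D"
    and "independent_ops smul (poisson scl br b) (derived_op D (poisson scl br b))"
    and "absolute_value av"
    and "exp_converges av D"
  shows "generated_subalgebra {(D ^^ n) z |n z. z \<in> centre (poisson scl br b)} =
         generated_subalgebra (\<Union>s. centre (exp_transport av s D (poisson scl br b)))"
proof -
  define Z where "Z = centre (poisson scl br b)"
  interpret exponentiable av D
    using assms
    by (intro exponentiable.intro valued_field.intro exponentiable_axioms.intro)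
      (simp_all add: near_derivation_def)
  let ?X = "{(D ^^ n) z |n z. z \<in> Z}" and ?Y = "\<Union>s. exp_map av s D ` Z"
  have "?X \<subseteq> generated_subalgebra ?Y"
  proof clarify
    fix n z assume "z \<in> Z"
    then have "range (\<lambda>s. exp_map av s D z) \<subseteq> ?Y" by blast
    from span_subset_generated_subalgebra[OF this] show "(D ^^ n) z \<in> generated_subalgebra ?Y"
      unfolding span_exp_orbit using D.vs1.span_superset[of "range (\<lambda>n. (D ^^ n) z)"] by blast
  qed
  moreover have "?Y \<subseteq> generated_subalgebra ?X"
  proof clarify
    fix s z assume "z \<in> Z"
    then have "range (\<lambda>n. (D ^^ n) z) \<subseteq> ?X" by blast
    from span_subset_generated_subalgebra[OF this] show "exp_map av s D z \<in> generated_subalgebra ?X"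
      unfolding span_exp_orbit[symmetric]
      using D.vs1.span_superset[of "range (\<lambda>s. exp_map av s D z)"] by blast
  qed
  ultimately show ?thesis
    unfolding centre_exp_transport Z_def[symmetric]
    by (intro subset_antisym generated_subalgebra_subsetI)
qed

end
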